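(* Let $1\le p<\infty$ and let $\mathcal K=\{K_i: i\in I\}$ be a family of disjoint compact Hausdorff spaces. If a Banach space $X$ is $(p,\mathcal K)$-representable, then it has the $p$-Daugavet property.
   Context: All Banach spaces are real; $B_X$ is the closed unit ball of $X$. Let $1\le p<\infty$. A Banach function space over a measure space $(\Omega,\Sigma,\mu)$ is an ideal of $L^0(\mu)$ (classes of a.e. equal real measurable functions, with the a.e. order) that is a Banach space with a lattice norm and contains $\chi_A$ for every $A\in\Sigma$ of finite measure. It is constant~$1$ $p$-convex if $\|(\sum_{i=1}^n|x_i|^p)^{1/p}\|\le(\sum_{i=1}^n\|x_i\|^p)^{1/p}$ for all finite families $x_1,\dots,x_n$. $C(K)$-spaces (real continuous functions on a compact Hausdorff space) carry the sup norm. Signed powers: for a real (class of) function(s) $f$, $f^p$ denotes the pointwise signed power $\operatorname{sign}\{f\}|f|^p$ (which need not equal $|f|^p$), and $(\cdot)^{1/p}$ its inverse, $g^{1/p}=\operatorname{sign}\{g\}|g|^{1/p}$; for elements of a product of function spaces these operations are applied coordinatewise. Let $I$ be an index set and $\mathcal K=\{K_i:i\in I\}$ a family of (disjoint) compact Hausdorff spaces. A Banach space $X$ is $(p,\mathcal K)$-representable if there exists a family $(X_k)_{k\in\bigcup_{i\in I}K_i}$, each $X_k$ being a constant~$1$ $p$-convex Banach function space or a $C(K)$-space, such that: (i) Each $x\in X$ can be identified linearly with its coordinates $(x(k))_k$ in the product $\prod_{k\in\bigcup_{i\in I}K_i}X_k$, and for each $i\in I$ the restriction $x|_i$ of $x$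 to $\prod_{k\in K_i}X_k$ (equal to $x(k)$ for $k\in K_i$ and $0$ at the other coordinates) belongs to $X$. Also, for every finite family $x_1,\dots,x_n\in X$ the element $(\sum_{\nu=1}^n x_\nu^p)^{1/p}$, defined pointwise by means of the representation, belongs to $X$. (ii) For every $x\in X$ and every $(\varphi_i)_{i\in I}$ in the $\ell^\infty$-sum $\bigoplus_{i\in I}^{\infty}C(K_i)$ (sup norm), the product $(\varphi_i)x=(\varphi_i\,x|_i)_{i}$, i.e. the element with coordinates $\varphi_i(k)x(k)$ for $k\in K_i$, belongs to $X$. (iii) For every $x\in X$, $\|x\|=\sup\{(\sum_{j\in F}\|x(k_j)\|^p)^{1/p}: F\subset I\text{ finite},\ k_j\in K_j\}<\infty$. (iv) For every $x\in X$, $i\in I$ and $\varepsilon>0$, the set $\{k\in K_i:\|x(k)\|\ge(1-\varepsilon)\|x|_i\|\}$ is infinite. Such a space $X$ is regarded, via its representation, as a space of functions with signed $p$-th powers computed pointwise. It has the $p$-Daugavet property if for every rank one continuous linear operator $T: X\to X$ one has $\sup_{f\in B_X}\|(f^p+T(f)^p)^{1/p}\|=(1+\|T\|^p)^{1/p}$ (note that $(f^p+T(f)^p)^{1/p}\in X$ by (i)). *)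

theory Defs
  imports "HOL-Analysis.Analysis"
begin

text \<open>
  Signed power \<open>sign(s) |s|\<^sup>p\<close> of a real number; for \<open>p > 0\<close> the inverse operation is
  \<open>spow (1 / p)\<close>.
\<close>

definition spow :: "real \<Rightarrow> real \<Rightarrow> real" where
  "spow p s = sgn s * \<bar>s\<bar> powr p"

text \<open>
  A normed space of (classes of) real functions is given by the set of all representatives of its
  elements, the relation saying that two representatives define the same element, and the norm,
  read as a function of the representative. The functions are total on the type \<open>'w\<close>; all data
  below depend only on their values on the underlying set (the space of a measure, or the
  topspace of a topology), so the spaces \<open>X\<^sub>k\<close> of a family may live on different underlying sets.
\<close>

record 'w fun_space =
  carr :: "('w \<Rightarrow> real) set"
  eqv :: "('w \<Rightarrow> real) \<Rightarrow> ('w \<Rightarrow> real) \<Rightarrow> bool"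
  nrm :: "('w \<Rightarrow> real) \<Rightarrow> real"

locale banach_function_space =
  fixes M :: "'w measure" and E :: "'w fun_space"
  assumes carr_measurable: "carr E \<subseteq> borel_measurable M"
    and eqv_iff_AE: "eqv E f g \<longleftrightarrow> (AE t in M. f t = g t)"
    and zero_mem: "(\<lambda>t. 0) \<in> carr E"
    and add_mem: "f \<in> carr E \<Longrightarrow> g \<in> carr E \<Longrightarrow> (\<lambda>t. f t + g t) \<in> carr E"
    and scale_mem: "f \<in> carr E \<Longrightarrow> (\<lambda>t. c * f t) \<in> carr E"
    \<comment> \<open>together with \<open>lattice_norm\<close>, this makes \<open>carr E\<close> and the norm invariant under a.e. equality\<close>
    and ideal: "f \<in> carr E \<Longrightarrow> g \<in> borel_measurable M \<Longrightarrow> (AE t in M. \<bar>g t\<bar> \<le> \<bar>f t\<bar>) \<Longrightarrow> g \<in> carr E"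
    and nrm_eq_zero: "f \<in> carr E \<Longrightarrow> nrm E f = 0 \<longleftrightarrow> (AE t in M. f t = 0)"
    and nrm_triangle: "f \<in> carr E \<Longrightarrow> g \<in> carr E \<Longrightarrow> nrm E (\<lambda>t. f t + g t) \<le> nrm E f + nrm E g"
    and nrm_scale: "f \<in> carr E \<Longrightarrow> nrm E (\<lambda>t. c * f t) = \<bar>c\<bar> * nrm E f"
    and lattice_norm: "f \<in> carr E \<Longrightarrow> g \<in> carr E \<Longrightarrow> (AE t in M. \<bar>g t\<bar> \<le> \<bar>f t\<bar>) \<Longrightarrow> nrm E g \<le> nrm E f"
    and complete:
      "(\<And>n. s n \<in> carr E) \<Longrightarrow>
       (\<forall>e>0. \<exists>N. \<forall>m\<ge>N. \<forall>n\<ge>N. nrm E (\<lambda>t. s m t - s n t) < e) \<Longrightarrow>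
       \<exists>f\<in>carr E. (\<lambda>n. nrm E (\<lambda>t. s n t - f t)) \<longlonglongrightarrow> 0"
    and indicator_mem: "A \<in> sets M \<Longrightarrow> emeasure M A < \<infinity> \<Longrightarrow> indicator A \<in> carr E"

definition const1_p_convex :: "real \<Rightarrow> 'w fun_space \<Rightarrow> bool" where
  "const1_p_convex p E \<longleftrightarrow>
     (\<forall>(n::nat) x. (\<forall>i<n. x i \<in> carr E) \<longrightarrow>
        nrm E (\<lambda>t. (\<Sum>i<n. \<bar>x i t\<bar> powr p) powr (1 / p)) \<le> (\<Sum>i<n. nrm E (x i) powr p) powr (1 / p))"

text \<open>
  The space of continuous functions on a topological space with the sup norm. Inserting \<open>0\<close> only
  matters for the empty space, where \<open>Sup {}\<close> would be unspecified.
\<close>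

definition C_space :: "'w topology \<Rightarrow> 'w fun_space" where
  "C_space L =
     \<lparr> carr = {f. continuous_map L euclideanreal f},
       eqv = (\<lambda>f g. \<forall>t\<in>topspace L. f t = g t),
       nrm = (\<lambda>f. Sup (insert 0 ((\<lambda>t. \<bar>f t\<bar>) ` topspace L))) \<rparr>"

definition admissible :: "real \<Rightarrow> 'w fun_space \<Rightarrow> bool" where
  "admissible p E \<longleftrightarrow>
     (\<exists>M. banach_function_space M E \<and> const1_p_convex p E) \<or>
     (\<exists>L. compact_space L \<and> Hausdorff_space L \<and> E = C_space L)"

text \<open>
  The Banach space is the type \<open>'x\<close>; \<open>R x k\<close> is (a representative of) the coordinate \<open>x(k)\<close>, for
  \<open>k\<close> in the index set \<open>U\<close>. The predicate \<open>has_coords\<close> says that the family \<open>z\<close> belongs to the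
  space and is identified with its element \<open>y\<close>.
\<close>

definition has_coords ::
  "'k set \<Rightarrow> ('k \<Rightarrow> 'w fun_space) \<Rightarrow> ('x \<Rightarrow> 'k \<Rightarrow> 'w \<Rightarrow> real) \<Rightarrow> 'x \<Rightarrow> ('k \<Rightarrow> 'w \<Rightarrow> real) \<Rightarrow> bool" where
  "has_coords U X R y z \<longleftrightarrow> (\<forall>k\<in>U. eqv (X k) (R y k) (z k))"

text \<open>The coordinates of the restriction of \<open>x\<close> to the block \<open>B\<close> of indices.\<close>

definition restr_coords ::
  "('x \<Rightarrow> 'k \<Rightarrow> 'w \<Rightarrow> real) \<Rightarrow> 'x \<Rightarrow> 'k set \<Rightarrow> 'k \<Rightarrow> 'w \<Rightarrow> real" where
  "restr_coords R x B k = (if k \<in> B then R x k else (\<lambda>t. 0))"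

definition index_union :: "'i set \<Rightarrow> ('i \<Rightarrow> 'k topology) \<Rightarrow> 'k set" where
  "index_union I K = (\<Union>i\<in>I. topspace (K i))"

locale pK_representation =
  fixes p :: real and I :: "'i set" and K :: "'i \<Rightarrow> 'k topology"
    and X :: "'k \<Rightarrow> 'w fun_space" and R :: "'x::banach \<Rightarrow> 'k \<Rightarrow> 'w \<Rightarrow> real"
  assumes spaces: "k \<in> index_union I K \<Longrightarrow> admissible p (X k)"
    and coord_mem: "k \<in> index_union I K \<Longrightarrow> R x k \<in> carr (X k)"
    and coord_add: "has_coords (index_union I K) X R (x + y) (\<lambda>k t. R x k t + R y k t)"
    and coord_scale: "has_coords (index_union I K) X R (c *\<^sub>R x) (\<lambda>k t. c * R x k t)"
    and coord_inj: "has_coords (index_union I K) X R x (R y) \<Longrightarrow> x = y"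
    and restr: "i \<in> I \<Longrightarrow>
      \<exists>y. has_coords (index_union I K) X R y (restr_coords R x (topspace (K i)))"
    and p_sum: "\<exists>y. has_coords (index_union I K) X R y
      (\<lambda>k t. spow (1 / p) (\<Sum>\<nu><(n::nat). spow p (R (xs \<nu>) k t)))"
    \<comment> \<open>\<open>\<phi>\<close> is a family in the \<open>\<ell>\<^sup>\<infinity>\<close>-sum of the \<open>C(K\<^sub>i)\<close>; the \<open>K\<^sub>i\<close> being disjoint, \<open>y\<close> is one element\<close>
    and module: "(\<And>i. i \<in> I \<Longrightarrow> continuous_map (K i) euclideanreal (\<phi> i)) \<Longrightarrow>
      (\<exists>B. \<forall>i\<in>I. \<forall>k\<in>topspace (K i). \<bar>\<phi> i k\<bar> \<le> B) \<Longrightarrow>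
      \<exists>y. \<forall>i\<in>I. has_coords (topspace (K i)) X R y (\<lambda>k t. \<phi> i k * R x k t)"
    and norm_eq: "ereal (norm x) =
      (SUP (F, \<kappa>) \<in> {(F, \<kappa>). finite F \<and> F \<subseteq> I \<and> (\<forall>j\<in>F. \<kappa> j \<in> topspace (K j))}.
         ereal ((\<Sum>j\<in>F. nrm (X (\<kappa> j)) (R x (\<kappa> j)) powr p) powr (1 / p)))"
    and almost_max_infinite: "i \<in> I \<Longrightarrow> \<epsilon> > 0 \<Longrightarrow>
      has_coords (index_union I K) X R y (restr_coords R x (topspace (K i))) \<Longrightarrow>
      infinite {k \<in> topspace (K i). nrm (X k) (R x k) \<ge> (1 - \<epsilon>) * norm y}"

text \<open>
  The element \<open>(f\<^sup>p + g\<^sup>p)\<^sup>1\<^sup>/\<^sup>p\<close>, computed pointwise. In a \<open>pK_representation\<close> it exists by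
  \<open>p_sum\<close> and is unique by \<open>coord_inj\<close>.
\<close>

definition p_add ::
  "real \<Rightarrow> 'k set \<Rightarrow> ('k \<Rightarrow> 'w fun_space) \<Rightarrow> ('x \<Rightarrow> 'k \<Rightarrow> 'w \<Rightarrow> real) \<Rightarrow> 'x \<Rightarrow> 'x \<Rightarrow> 'x" where
  "p_add p U X R f g =
     (THE y. has_coords U X R y (\<lambda>k t. spow (1 / p) (spow p (R f k t) + spow p (R g k t))))"

definition p_Daugavet ::
  "real \<Rightarrow> 'k set \<Rightarrow> ('k \<Rightarrow> 'w fun_space) \<Rightarrow> ('x::banach \<Rightarrow> 'k \<Rightarrow> 'w \<Rightarrow> real) \<Rightarrow> bool" where
  "p_Daugavet p U X R \<longleftrightarrow>
     (\<forall>T::'x \<Rightarrow> 'x. bounded_linear T \<and> dim (range T) = 1 \<longrightarrow>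
        (SUP f\<in>cball 0 1. ereal (norm (p_add p U X R f (T f)))) =
          ereal ((1 + onorm T powr p) powr (1 / p)))"

end

(*
  A rank one operator is T = h(.) y, and the functional h and the vector y can be chosen with
  y = T f and h(f) = 1 for a unit vector f with norm (T f) close to the norm of T. The p-th power of
  the norm of X is the l^1-sum over i of the p-th powers of the block norms, so finitely many
  blocks carry most of f and of y. In each of them infinitely many points almost attain the norm
  of y; peaks at many of these points with disjoint supports cut any vector into pieces on one of
  which h is small. There f is replaced, at no cost for its norm, by a nonnegative multiple of y
  with the norm of the f-block, which gives a vector g in the unit ball with h(g) close to 1.
  Where g and T g are nonnegative multiples of the same function, the p-th powers of their norms
  add exactly. The upper bound is p-convexity in each coordinate.
*)

theory Submission
  imports Defs
begin

section \<open>Signed powers of real numbers\<close>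

lemma abs_spow: "\<bar>spow p s\<bar> = \<bar>s\<bar> powr p"
  by (simp add: spow_def abs_mult abs_sgn_eq)

lemma spow_scale:
  assumes "c \<ge> 0"
  shows "spow p (c * s) = c powr p * spow p s"
  using assms by (cases "c = 0") (auto simp: spow_def sgn_mult abs_mult powr_mult)

lemma spow_inverse:
  assumes "p > 0"
  shows "spow (1 / p) (spow p s) = s"
  using assms by (cases "s = 0") (auto simp: spow_def sgn_mult abs_mult abs_sgn_eq powr_powr sgn_mult_abs)

text \<open>The signed power is multiplicative in a nonnegative factor, so \<open>spow p s\<close>
  can be taken out of the sum and inverted. This is the source of every exact equality for
  \<open>p_add\<close> below.\<close>

lemma spow_add_scaled:
  assumes "p > 0" "a \<ge> 0" "b \<ge> 0"
  shows "spow (1 / p) (spow p (a * s) + spow p (b * s)) = (a powr p + b powr p) powr (1 / p) * s"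
proof -
  have "spow p (a * s) + spow p (b * s) = (a powr p + b powr p) * spow p s"
    using assms by (simp add: spow_scale algebra_simps)
  then show ?thesis
    using assms by (simp add: spow_scale spow_inverse)
qed

lemma powr_abs_spow_add_le:
  assumes "p > 0"
  shows "\<bar>spow (1 / p) (spow p a + spow p b)\<bar> powr p \<le> \<bar>a\<bar> powr p + \<bar>b\<bar> powr p"
  using assms by (auto simp: abs_spow powr_powr intro: order_trans[OF abs_triangle_ineq])

section \<open>The two kinds of coordinate spaces and their common properties\<close>

lemma bdd_above_abs_continuous_map:
  assumes "compact_space L" "continuous_map L euclideanreal f"
  shows "bdd_above (insert 0 ((\<lambda>t. \<bar>f t\<bar>) ` topspace L))"
proof -
  have "compactin euclideanreal (f ` topspace L)"
    using assms image_compactin compact_space_def by blast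
  then have "bounded (f ` topspace L)"
    by (simp add: compact_imp_bounded)
  then obtain B where "\<And>t. t \<in> topspace L \<Longrightarrow> \<bar>f t\<bar> \<le> B"
    by (auto simp: bounded_iff)
  then show ?thesis
    by (intro bdd_aboveI2[THEN bdd_above_insert[THEN iffD2]]) auto
qed

lemma C_space_nrm_ge:
  assumes "compact_space L" "f \<in> carr (C_space L)" "t \<in> topspace L"
  shows "\<bar>f t\<bar> \<le> nrm (C_space L) f"
  using assms bdd_above_abs_continuous_map[of L f]
  by (auto simp: C_space_def intro!: cSup_upper)

lemma C_space_nrm_le:
  assumes "0 \<le> B" "\<And>t. t \<in> topspace L \<Longrightarrow> \<bar>f t\<bar> \<le> B"
  shows "nrm (C_space L) f \<le> B"
  using assms by (auto simp: C_space_def intro!: cSup_least)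

lemma C_space_nrm_nonneg:
  assumes "compact_space L" "f \<in> carr (C_space L)"
  shows "0 \<le> nrm (C_space L) f"
  using assms bdd_above_abs_continuous_map[of L f]
  by (auto simp: C_space_def intro!: cSup_upper)

text \<open>
  What the argument uses of an admissible space, with "almost everywhere" replaced by
  "eventually" along a filter, so that both kinds of spaces are treated at once.
\<close>

locale p_convex_space =
  fixes p :: real and E :: "'w fun_space" and G :: "'w filter"
  assumes eqv_iff: "eqv E f g \<longleftrightarrow> (\<forall>\<^sub>F t in G. f t = g t)"
    and add: "f \<in> carr E \<Longrightarrow> g \<in> carr E \<Longrightarrow> (\<lambda>t. f t + g t) \<in> carr E"
    and scale: "f \<in> carr E \<Longrightarrow> (\<lambda>t. c * f t) \<in> carr E"
    and triangle: "f \<in> carr E \<Longrightarrow> g \<in> carr E \<Longrightarrow> nrm E (\<lambda>t. f t + g t) \<le> nrm E f + nrm E g"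
    and homogeneous: "f \<in> carr E \<Longrightarrow> nrm E (\<lambda>t. c * f t) = \<bar>c\<bar> * nrm E f"
    and mono: "f \<in> carr E \<Longrightarrow> g \<in> carr E \<Longrightarrow> (\<forall>\<^sub>F t in G. \<bar>g t\<bar> \<le> \<bar>f t\<bar>) \<Longrightarrow> nrm E g \<le> nrm E f"
    and zero_cond: "f \<in> carr E \<Longrightarrow> nrm E f = 0 \<Longrightarrow> (\<forall>\<^sub>F t in G. f t = 0)"
    and p_convex: "f \<in> carr E \<Longrightarrow> g \<in> carr E \<Longrightarrow> w \<in> carr E \<Longrightarrow>
      (\<forall>\<^sub>F t in G. \<bar>w t\<bar> powr p \<le> \<bar>f t\<bar> powr p + \<bar>g t\<bar> powr p) \<Longrightarrow>
      nrm E w powr p \<le> nrm E f powr p + nrm E g powr p"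
begin

lemma nonneg:
  assumes "f \<in> carr E"
  shows "0 \<le> nrm E f"
proof -
  have "nrm E (\<lambda>t. 0 * f t) \<le> nrm E f"
    by (rule mono[OF assms scale[OF assms]]) simp
  then show ?thesis
    using homogeneous[OF assms, of 0] by simp
qed

lemma nrm_cong:
  assumes "f \<in> carr E" "g \<in> carr E" "eqv E f g"
  shows "nrm E f = nrm E g"
proof (rule antisym)
  show "nrm E f \<le> nrm E g"
    using assms by (intro mono) (auto simp: eqv_iff elim: eventually_mono)
  show "nrm E g \<le> nrm E f"
    using assms by (intro mono) (auto simp: eqv_iff elim: eventually_mono)
qed

end

text \<open>Convexity with constant 1 bounds the norm of the particular function \<open>v\<close>,
  the pointwise p-sum of \<open>f\<close> and \<open>g\<close>. Once \<open>v\<close> is known to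
  lie in the space, the lattice norm carries the bound over to every \<open>w\<close> dominated by
  \<open>v\<close> almost everywhere.\<close>

lemma banach_function_space_imp_p_convex_space:
  assumes "1 \<le> p" "banach_function_space M E" "const1_p_convex p E"
  shows "p_convex_space p E (ae_filter M)"
proof -
  interpret banach_function_space M E by fact
  show ?thesis
  proof
    fix f g w
    assume f: "f \<in> carr E" and g: "g \<in> carr E" and w: "w \<in> carr E"
      and le: "AE t in M. \<bar>w t\<bar> powr p \<le> \<bar>f t\<bar> powr p + \<bar>g t\<bar> powr p"
    have [measurable]: "f \<in> borel_measurable M" "g \<in> borel_measurable M"
      using f g carr_measurable by auto
    define s where "s = (\<lambda>t. \<bar>f t\<bar> + \<bar>g t\<bar>)"
    define v where "v = (\<lambda>t. (\<bar>f t\<bar> powr p + \<bar>g t\<bar> powr p) powr (1 / p))"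
    have "(\<lambda>t. \<bar>f t\<bar>) \<in> carr E" "(\<lambda>t. \<bar>g t\<bar>) \<in> carr E"
      by (auto intro: ideal[OF f] ideal[OF g])
    then have s: "(\<lambda>t. 2 * s t) \<in> carr E"
      unfolding s_def by (intro scale_mem add_mem)
    \<comment> \<open>A crude bound whose only use is that the ideal property then puts
      \<open>v\<close> into the space: both p-th powers are at most that of \<open>s\<close>, and 2
      \<le> 2^p since p \<ge> 1.\<close>
    have "\<bar>v t\<bar> \<le> \<bar>2 * s t\<bar>" for t
    proof -
      have "\<bar>f t\<bar> powr p \<le> s t powr p" "\<bar>g t\<bar> powr p \<le> s t powr p"
        using assms(1) by (auto simp: s_def intro!: powr_mono2)
      moreover have "2 * s t powr p \<le> 2 powr p * s t powr p"
        using assms(1) powr_mono[of 1 p 2] by (intro mult_right_mono) auto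
      ultimately have "\<bar>f t\<bar> powr p + \<bar>g t\<bar> powr p \<le> (2 * s t) powr p"
        using powr_mult[of 2 "s t" p] by (simp add: s_def del: distrib_left_numeral)
      then have "v t \<le> ((2 * s t) powr p) powr (1 / p)"
        unfolding v_def using assms(1) by (intro powr_mono2) auto
      also have "\<dots> = 2 * s t"
        using assms(1) by (simp add: powr_powr s_def)
      finally show ?thesis
        by (simp add: v_def s_def)
    qed
    moreover have "v \<in> borel_measurable M"
      unfolding v_def by measurable
    ultimately have v: "v \<in> carr E"
      using s by (auto intro: ideal)
    have "nrm E w \<le> nrm E v"
    proof (rule lattice_norm[OF v w])
      show "AE t in M. \<bar>w t\<bar> \<le> \<bar>v t\<bar>"
        using le
      proof (rule eventually_mono)
        fix t
        assume "\<bar>w t\<bar> powr p \<le> \<bar>f t\<bar> powr p + \<bar>g t\<bar> powr p"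
        then have "(\<bar>w t\<bar> powr p) powr (1 / p) \<le> v t"
          unfolding v_def using assms(1) by (intro powr_mono2) auto
        then show "\<bar>w t\<bar> \<le> \<bar>v t\<bar>"
          using assms(1) by (simp add: powr_powr)
      qed
    qed
    also have "nrm E v \<le> (nrm E f powr p + nrm E g powr p) powr (1 / p)"
    proof -
      \<comment> \<open>Only families of two functions are needed, encoded as a sequence whose value
        at 0 is \<open>f\<close> and at 1 is \<open>g\<close>.\<close>
      have "\<forall>i<2. (if i = (0::nat) then f else g) \<in> carr E"
        using f g by simp
      then have "nrm E (\<lambda>t. (\<Sum>i<2. \<bar>(if i = (0::nat) then f else g) t\<bar> powr p) powr (1 / p))
          \<le> (\<Sum>i<(2::nat). nrm E (if i = 0 then f else g) powr p) powr (1 / p)"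
        using assms(3)[unfolded const1_p_convex_def, THEN spec[of _ 2],
            THEN spec[of _ "\<lambda>i. if i = 0 then f else g"]] by (rule rev_mp)
      then show ?thesis by (simp add: v_def numeral_2_eq_2)
    qed
    finally have le': "nrm E w \<le> (nrm E f powr p + nrm E g powr p) powr (1 / p)" .
    have "0 \<le> nrm E w"
      using lattice_norm[OF w zero_mem] nrm_eq_zero[OF zero_mem] by simp
    then have "nrm E w powr p \<le> ((nrm E f powr p + nrm E g powr p) powr (1 / p)) powr p"
      using le' assms(1) by (intro powr_mono2) auto
    then show "nrm E w powr p \<le> nrm E f powr p + nrm E g powr p"
      using assms(1) by (simp add: powr_powr)
  qed (use eqv_iff_AE add_mem scale_mem nrm_triangle nrm_scale lattice_norm nrm_eq_zero in auto)
qed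

text \<open>With the principal filter of the underlying set, "eventually" means "at every point".
  Convexity then follows pointwise, because |f t| and |g t| are bounded by the sup norms.\<close>

lemma C_space_imp_p_convex_space:
  assumes "1 \<le> p" "compact_space L"
  shows "p_convex_space p (C_space L) (principal (topspace L))"
proof
  let ?E = "C_space L"
  note ge = C_space_nrm_ge[OF assms(2)] and nonneg = C_space_nrm_nonneg[OF assms(2)]
  show add: "(\<lambda>t. f t + g t) \<in> carr ?E" if "f \<in> carr ?E" "g \<in> carr ?E" for f g
    using that by (auto simp: C_space_def intro: continuous_map_add)
  show scale: "(\<lambda>t. c * f t) \<in> carr ?E" if "f \<in> carr ?E" for f c
    using that by (auto simp: C_space_def intro: continuous_map_real_mult)
  show "nrm ?E (\<lambda>t. f t + g t) \<le> nrm ?E f + nrm ?E g" if "f \<in> carr ?E" "g \<in> carr ?E" for f g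
    using that nonneg[of f] nonneg[of g] ge[of f] ge[of g]
    by (intro C_space_nrm_le) (auto intro: abs_triangle_ineq[THEN order_trans] add_mono)
  show "nrm ?E (\<lambda>t. c * f t) = \<bar>c\<bar> * nrm ?E f" if f: "f \<in> carr ?E" for f c
  proof (rule antisym)
    show "nrm ?E (\<lambda>t. c * f t) \<le> \<bar>c\<bar> * nrm ?E f"
      using f nonneg[of f] ge[of f]
      by (intro C_space_nrm_le) (auto simp: abs_mult intro: mult_left_mono)
    show "\<bar>c\<bar> * nrm ?E f \<le> nrm ?E (\<lambda>t. c * f t)"
    proof (cases "c = 0")
      case False
      have "nrm ?E f \<le> nrm ?E (\<lambda>t. c * f t) / \<bar>c\<bar>"
        using False nonneg[OF scale[OF f]] ge[OF scale[OF f, of c]]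
        by (intro C_space_nrm_le) (auto simp: abs_mult field_simps)
      then show ?thesis
        using False by (simp add: field_simps)
    qed (use nonneg[OF scale[OF f, of c]] in simp)
  qed
  show "nrm ?E g \<le> nrm ?E f"
    if "f \<in> carr ?E" "g \<in> carr ?E" "\<forall>\<^sub>F t in principal (topspace L). \<bar>g t\<bar> \<le> \<bar>f t\<bar>" for f g
    using that nonneg[of f] ge[of f]
    by (intro C_space_nrm_le) (auto simp: eventually_principal intro: order_trans)
  show "\<forall>\<^sub>F t in principal (topspace L). f t = 0" if "f \<in> carr ?E" "nrm ?E f = 0" for f
    using ge[of f] that by (force simp: eventually_principal)
  show "nrm ?E w powr p \<le> nrm ?E f powr p + nrm ?E g powr p"
    if fgw: "f \<in> carr ?E" "g \<in> carr ?E" "w \<in> carr ?E"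
      and le: "\<forall>\<^sub>F t in principal (topspace L). \<bar>w t\<bar> powr p \<le> \<bar>f t\<bar> powr p + \<bar>g t\<bar> powr p" for f g w
  proof -
    define B where "B = nrm ?E f powr p + nrm ?E g powr p"
    have "nrm ?E w \<le> B powr (1 / p)"
    proof (rule C_space_nrm_le)
      fix t assume t: "t \<in> topspace L"
      have "\<bar>w t\<bar> powr p \<le> \<bar>f t\<bar> powr p + \<bar>g t\<bar> powr p"
        using le t by (simp add: eventually_principal)
      also have "\<dots> \<le> B"
        unfolding B_def using fgw t assms(1) ge by (intro add_mono powr_mono2) auto
      finally have "(\<bar>w t\<bar> powr p) powr (1 / p) \<le> B powr (1 / p)"
        using assms(1) by (intro powr_mono2) auto
      then show "\<bar>w t\<bar> \<le> B powr (1 / p)"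
        using assms(1) by (simp add: powr_powr)
    qed simp
    then have "nrm ?E w powr p \<le> (B powr (1 / p)) powr p"
      using nonneg[OF fgw(3)] assms(1) by (intro powr_mono2) auto
    then show ?thesis
      using assms(1) by (simp add: powr_powr B_def)
  qed
qed (simp add: C_space_def eventually_principal)

lemma admissible_imp_p_convex_space:
  assumes "1 \<le> p" "admissible p E"
  shows "\<exists>G. p_convex_space p E G"
  using assms banach_function_space_imp_p_convex_space C_space_imp_p_convex_space
  unfolding admissible_def by blast

section \<open>Peak functions at many points of a compact Hausdorff space\<close>

lemma continuous_map_interpolating:
  assumes "compact_space L" "Hausdorff_space L" "finite S" "S \<subseteq> topspace L"
  obtains g where "continuous_map L euclideanreal g" "\<And>x. x \<in> S \<Longrightarrow> g x = f x"
proof -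
  \<comment> \<open>Every function on a finite set of a Hausdorff space is continuous, the subspace
    being discrete. As the set is closed and the space normal, Tietze's theorem extends the
    function.\<close>
  have "subtopology L S = discrete_topology S"
    using assms by (intro finite_t1_space_imp_discrete_topology)
      (auto simp: Hausdorff_imp_t1_space t1_space_subtopology)
  then have "continuous_map (subtopology L S) euclideanreal f"
    by simp
  moreover have "closedin L S"
    using assms using Hausdorff_imp_t1_space t1_space_closedin_finite by blast
  moreover have "normal_space L"
    using assms by (simp add: compact_Hausdorff_or_regular_imp_normal_space)
  ultimately show thesis
    using Tietze_extension_realinterval[of L S UNIV f] that by auto
qed

text \<open>The tent around \<open>n\<close> is positive only at distance less than 1/2 from
  \<open>n\<close>, so at most one tent is positive at \<open>r\<close>, and each is at most
  1.\<close>

lemma sum_tents_le_1: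
  "(\<Sum>n<N. max 0 (1 - 2 * \<bar>r - real n\<bar>)) \<le> 1"
proof (cases "\<exists>m. \<bar>r - real m\<bar> < 1 / 2")
  case True
  then obtain m where m: "\<bar>r - real m\<bar> < 1 / 2" by blast
  have "max 0 (1 - 2 * \<bar>r - real n\<bar>) \<le> (if n = m then 1 else 0)" for n
  proof (cases "n = m")
    case False
    then have "\<bar>real n - real m\<bar> \<ge> 1" by linarith
    then have "\<bar>r - real n\<bar> \<ge> 1 / 2" using m by linarith
    then show ?thesis using False by (simp add: max_def)
  qed auto
  then have "(\<Sum>n<N. max 0 (1 - 2 * \<bar>r - real n\<bar>)) \<le> (\<Sum>n<N. if n = m then 1 else 0)"
    by (intro sum_mono) auto
  also have "\<dots> \<le> 1" by simp
  finally show ?thesis .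
next
  case False
  then have "max 0 (1 - 2 * \<bar>r - real n\<bar>) = 0" for n
    by (smt (verit) field_sum_of_halves)
  then show ?thesis by simp
qed

text \<open>A continuous \<open>g\<close> takes the value \<open>n\<close> at the
  \<open>n\<close>-th chosen point of \<open>S\<close>. Composing it with the tents around the
  integers gives peaks with disjoint supports, without separating the points by open sets.\<close>

lemma peaks_in_infinite_set:
  assumes "compact_space L" "Hausdorff_space L" "infinite S" "S \<subseteq> topspace L"
  shows "\<exists>\<kappa> \<psi>. \<forall>n<N::nat. \<kappa> n \<in> S \<and> continuous_map L euclideanreal (\<psi> n) \<and> \<psi> n (\<kappa> n) = 1 \<and>
    (\<forall>k. 0 \<le> \<psi> n k \<and> (\<Sum>m<N. \<psi> m k) \<le> 1)"
proof -
  obtain e :: "nat \<Rightarrow> 'a" where e: "inj e" "range e \<subseteq> S"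
    using assms(3) infinite_countable_subset by blast
  obtain g where g: "continuous_map L euclideanreal g"
    "\<And>x. x \<in> e ` {..<N} \<Longrightarrow> g x = real (inv e x)"
    by (rule continuous_map_interpolating[of L "e ` {..<N}" "\<lambda>x. real (inv e x)"])
      (use assms(1,2,4) e(2) in \<open>auto simp: image_subset_iff\<close>)
  have "continuous_map L euclideanreal (\<lambda>k. max 0 (1 - 2 * \<bar>g k - real n\<bar>))" for n
    by (intro continuous_intros g)
  moreover have "max 0 (1 - 2 * \<bar>g (e n) - real n\<bar>) = 1" if "n < N" for n
    using g(2)[of "e n"] that e(1) by simp
  ultimately show ?thesis
    using e sum_tents_le_1
    by (intro exI[of _ e] exI[of _ "\<lambda>n k. max 0 (1 - 2 * \<bar>g k - real n\<bar>)"]) auto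
qed

section \<open>Coordinates, norms and block norms in a representable space\<close>

locale pK_compact_representation = pK_representation p I K X R
  for p :: real and I :: "'i set" and K :: "'i \<Rightarrow> 'k topology"
    and X :: "'k \<Rightarrow> 'w fun_space" and R :: "'x::banach \<Rightarrow> 'k \<Rightarrow> 'w \<Rightarrow> real" +
  assumes p_ge_1: "1 \<le> p"
    and compact: "i \<in> I \<Longrightarrow> compact_space (K i)"
    and Hausdorff: "i \<in> I \<Longrightarrow> Hausdorff_space (K i)"
begin

abbreviation U :: "'k set" where
  "U \<equiv> index_union I K"

abbreviation N :: "'x \<Rightarrow> 'k \<Rightarrow> real" where
  "N x k \<equiv> nrm (X k) (R x k)"

text \<open>One filter is fixed for each coordinate, so that equality of coordinates can be handled
  as eventual equality and combined by \<open>eventually_elim\<close>, whichever kind of space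
  \<open>X k\<close> is.\<close>

definition filt :: "'k \<Rightarrow> 'w filter" where
  "filt k = (SOME G. p_convex_space p (X k) G)"

lemma p_convex_space_filt: "k \<in> U \<Longrightarrow> p_convex_space p (X k) (filt k)"
  unfolding filt_def by (rule someI_ex, rule admissible_imp_p_convex_space[OF p_ge_1 spaces])

lemma eqv_iff_filt: "k \<in> U \<Longrightarrow> eqv (X k) f g \<longleftrightarrow> (\<forall>\<^sub>F t in filt k. f t = g t)"
  by (rule p_convex_space.eqv_iff[OF p_convex_space_filt])

lemma mem_index_union: "i \<in> I \<Longrightarrow> k \<in> topspace (K i) \<Longrightarrow> k \<in> U"
  by (auto simp: index_union_def)

lemma N_nonneg: "k \<in> U \<Longrightarrow> 0 \<le> N x k"
  using p_convex_space.nonneg[OF p_convex_space_filt] coord_mem by blast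

lemma eventually_R_add: "k \<in> U \<Longrightarrow> \<forall>\<^sub>F t in filt k. R (x + y) k t = R x k t + R y k t"
  using coord_add[of x y] by (simp add: has_coords_def eqv_iff_filt)

lemma eventually_R_scale: "k \<in> U \<Longrightarrow> \<forall>\<^sub>F t in filt k. R (c *\<^sub>R x) k t = c * R x k t"
  using coord_scale[of c x] by (simp add: has_coords_def eqv_iff_filt)

lemma eventually_R_diff:
  assumes "k \<in> U"
  shows "\<forall>\<^sub>F t in filt k. R (x - y) k t = R x k t - R y k t"
  using eventually_R_add[OF assms, of x "(-1) *\<^sub>R y"] eventually_R_scale[OF assms, of "-1" y]
  by eventually_elim simp

lemma eventually_R_0: "k \<in> U \<Longrightarrow> \<forall>\<^sub>F t in filt k. R 0 k t = 0"
  using eventually_R_scale[of k 0 0] by simp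

lemma R_eqI:
  assumes "\<And>k. k \<in> U \<Longrightarrow> \<forall>\<^sub>F t in filt k. R x k t = R y k t"
  shows "x = y"
  using assms by (intro coord_inj) (simp add: has_coords_def eqv_iff_filt)

lemma N_combination_le:
  assumes k: "k \<in> U" and w: "\<forall>\<^sub>F t in filt k. R w k t = a * R x k t + b * R y k t"
  shows "N w k \<le> \<bar>a\<bar> * N x k + \<bar>b\<bar> * N y k"
proof -
  interpret p_convex_space p "X k" "filt k"
    by (rule p_convex_space_filt[OF k])
  note mem = coord_mem[OF k]
  have "N w k = nrm (X k) (\<lambda>t. a * R x k t + b * R y k t)"
    using w by (intro nrm_cong mem add scale) (simp add: eqv_iff)
  also have "\<dots> \<le> \<bar>a\<bar> * N x k + \<bar>b\<bar> * N y k"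
    using triangle[OF scale[OF mem] scale[OF mem], of a x b y] homogeneous[OF mem] by simp
  finally show ?thesis .
qed

lemma N_multiple:
  assumes k: "k \<in> U" and w: "\<forall>\<^sub>F t in filt k. R w k t = a * R x k t"
  shows "N w k = \<bar>a\<bar> * N x k"
proof -
  interpret p_convex_space p "X k" "filt k"
    by (rule p_convex_space_filt[OF k])
  note mem = coord_mem[OF k]
  have "N w k = nrm (X k) (\<lambda>t. a * R x k t)"
    using w by (intro nrm_cong mem scale) (simp add: eqv_iff)
  then show ?thesis
    using homogeneous[OF mem] by simp
qed

lemma sum_N_powr_le_norm:
  assumes "finite F" "F \<subseteq> I" "\<And>j. j \<in> F \<Longrightarrow> \<kappa> j \<in> topspace (K j)"
  shows "(\<Sum>j\<in>F. N x (\<kappa> j) powr p) \<le> norm x powr p"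
proof -
  let ?S = "\<Sum>j\<in>F. N x (\<kappa> j) powr p"
  have "ereal (?S powr (1 / p)) \<le> ereal (norm x)"
    unfolding norm_eq[of x] using assms by (intro SUP_upper2[of "(F, \<kappa>)"]) auto
  then have "(?S powr (1 / p)) powr p \<le> norm x powr p"
    using p_ge_1 by (intro powr_mono2) auto
  then show ?thesis
    using p_ge_1 by (simp add: powr_powr sum_nonneg)
qed

lemma norm_le_of_sums:
  assumes "0 \<le> C" and "\<And>F \<kappa>. finite F \<Longrightarrow> F \<subseteq> I \<Longrightarrow> (\<And>j. j \<in> F \<Longrightarrow> \<kappa> j \<in> topspace (K j)) \<Longrightarrow>
    (\<Sum>j\<in>F. N x (\<kappa> j) powr p) \<le> C powr p"
  shows "norm x \<le> C"
proof -
  have "ereal (norm x) \<le> ereal C"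
    unfolding norm_eq[of x]
  proof (rule SUP_least, clarify)
    fix F \<kappa> assume "finite F" "F \<subseteq> I" "\<forall>j\<in>F. \<kappa> j \<in> topspace (K j)"
    then have "(\<Sum>j\<in>F. N x (\<kappa> j) powr p) powr (1 / p) \<le> (C powr p) powr (1 / p)"
      using assms p_ge_1 by (intro powr_mono2) (auto intro: sum_nonneg)
    then show "ereal ((\<Sum>j\<in>F. N x (\<kappa> j) powr p) powr (1 / p)) \<le> ereal C"
      using assms p_ge_1 by (simp add: powr_powr)
  qed
  then show ?thesis by simp
qed

lemma norm_approx:
  assumes "0 \<le> a" "a < norm x"
  shows "\<exists>F \<kappa>. finite F \<and> F \<subseteq> I \<and> (\<forall>j\<in>F. \<kappa> j \<in> topspace (K j)) \<and>
    a powr p \<le> (\<Sum>j\<in>F. N x (\<kappa> j) powr p)"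
proof (rule ccontr)
  assume "\<not> ?thesis"
  then have *: "\<not> a powr p \<le> (\<Sum>j\<in>F. N x (\<kappa> j) powr p)"
    if "finite F" "F \<subseteq> I" "\<forall>j\<in>F. \<kappa> j \<in> topspace (K j)" for F \<kappa>
    using that by blast
  have "norm x \<le> a"
    using assms(1)
  proof (rule norm_le_of_sums)
    show "(\<Sum>j\<in>F. N x (\<kappa> j) powr p) \<le> a powr p"
      if "finite F" "F \<subseteq> I" "\<And>j. j \<in> F \<Longrightarrow> \<kappa> j \<in> topspace (K j)" for F \<kappa>
      using *[of F \<kappa>] that by simp
  qed
  then show False
    using assms(2) by simp
qed

lemma N_le_norm:
  assumes "i \<in> I" "k \<in> topspace (K i)"
  shows "N x k \<le> norm x"
proof -
  have "N x k powr p \<le> norm x powr p"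
    using sum_N_powr_le_norm[of "{i}" "\<lambda>_. k" x] assms by simp
  then show ?thesis
    using p_ge_1 powr_less_mono2[of p "norm x" "N x k"] by force
qed

text \<open>For \<open>i\<close> in \<open>I\<close> the chosen element exists by
  \<open>restr\<close> and is unique by \<open>coord_inj\<close>.\<close>

definition block_norm :: "'x \<Rightarrow> 'i \<Rightarrow> real" where
  "block_norm x i =
     norm (SOME y. has_coords U X R y (restr_coords R x (topspace (K i))))"

lemma block_norm_restr:
  assumes "i \<in> I"
  obtains y where "has_coords U X R y (restr_coords R x (topspace (K i)))"
    "norm y = block_norm x i" "\<And>k. k \<in> topspace (K i) \<Longrightarrow> N y k = N x k"
proof -
  define y where "y = (SOME y. has_coords U X R y (restr_coords R x (topspace (K i))))"
  have y: "has_coords U X R y (restr_coords R x (topspace (K i)))"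
    unfolding y_def by (rule someI_ex[OF restr[OF assms]])
  moreover have "N y k = N x k" if "k \<in> topspace (K i)" for k
  proof -
    have k: "k \<in> U"
      using assms that by (rule mem_index_union)
    then have "\<forall>\<^sub>F t in filt k. R y k t = 1 * R x k t"
      using bspec[OF y[unfolded has_coords_def] k] that k
      by (simp add: restr_coords_def eqv_iff_filt)
    then show ?thesis
      using N_multiple[OF k, of y 1 x] by simp
  qed
  ultimately show thesis
    by (intro that[of y]) (simp_all add: block_norm_def y_def)
qed

lemma block_norm_nonneg: "0 \<le> block_norm x i"
  by (simp add: block_norm_def)

lemma N_le_block_norm:
  assumes "i \<in> I" "k \<in> topspace (K i)"
  shows "N x k \<le> block_norm x i"
  using block_norm_restr[OF assms(1), of x] N_le_norm[OF assms] assms(2) by metis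

lemma infinite_almost_block_norm:
  assumes "i \<in> I" "\<epsilon> > 0"
  shows "infinite {k \<in> topspace (K i). N x k \<ge> (1 - \<epsilon>) * block_norm x i}"
  using block_norm_restr[OF assms(1), of x] almost_max_infinite[OF assms] by metis

lemma sum_block_norm_le:
  assumes "finite F" "F \<subseteq> I"
  shows "(\<Sum>j\<in>F. block_norm x j powr p) \<le> norm x powr p"
proof (rule field_le_mult_one_interval)
  fix c :: real
  assume c: "0 < c" "c < 1"
  \<comment> \<open>Loosening the block norm by \<open>q\<close> changes its p-th power by exactly
    \<open>c\<close>.\<close>
  define q where "q = c powr (1 / p)"
  have q: "0 < q" "q < 1" "q powr p = c"
    using c p_ge_1 powr_less_mono2[of "1 / p" c 1] by (auto simp: q_def powr_powr)
  have "\<exists>k. k \<in> topspace (K j) \<and> N x k \<ge> q * block_norm x j" if "j \<in> F" for j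
    using infinite_almost_block_norm[of j "1 - q" x] that q assms(2)
    by (auto dest: infinite_imp_nonempty)
  then obtain \<kappa> where \<kappa>: "\<And>j. j \<in> F \<Longrightarrow> \<kappa> j \<in> topspace (K j) \<and> N x (\<kappa> j) \<ge> q * block_norm x j"
    by metis
  have "c * (\<Sum>j\<in>F. block_norm x j powr p) = (\<Sum>j\<in>F. (q * block_norm x j) powr p)"
    using q by (simp add: powr_mult block_norm_nonneg sum_distrib_left)
  also have "\<dots> \<le> (\<Sum>j\<in>F. N x (\<kappa> j) powr p)"
    using \<kappa> q p_ge_1 block_norm_nonneg by (intro sum_mono powr_mono2) auto
  also have "\<dots> \<le> norm x powr p"
    using \<kappa> assms by (intro sum_N_powr_le_norm) auto
  finally show "c * (\<Sum>j\<in>F. block_norm x j powr p) \<le> norm x powr p" .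
qed

text \<open>The bound is stated for all finite supersets, so that the sets found for two different
  vectors can be replaced by their union.\<close>

lemma finite_block_norm_approx:
  assumes "0 \<le> a" "a < norm x"
  obtains F where "finite F" "F \<subseteq> I"
    "\<And>F'. finite F' \<Longrightarrow> F \<subseteq> F' \<Longrightarrow> F' \<subseteq> I \<Longrightarrow> a powr p \<le> (\<Sum>j\<in>F'. block_norm x j powr p)"
proof -
  obtain F \<kappa> where F: "finite F" "F \<subseteq> I" "\<forall>j\<in>F. \<kappa> j \<in> topspace (K j)"
    "a powr p \<le> (\<Sum>j\<in>F. N x (\<kappa> j) powr p)"
    using norm_approx[OF assms] by blast
  show thesis
  proof (rule that[OF F(1,2)])
    fix F' assume F': "finite F'" "F \<subseteq> F'" "F' \<subseteq> I"
    have "(\<Sum>j\<in>F. N x (\<kappa> j) powr p) \<le> (\<Sum>j\<in>F. block_norm x j powr p)"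
      using F p_ge_1 by (intro sum_mono powr_mono2 N_le_block_norm N_nonneg mem_index_union) auto
    also have "\<dots> \<le> (\<Sum>j\<in>F'. block_norm x j powr p)"
      using F' by (intro sum_mono2) auto
    finally show "a powr p \<le> (\<Sum>j\<in>F'. block_norm x j powr p)"
      using F(4) by simp
  qed
qed

text \<open>At a point \<open>k\<close> the coordinate of \<open>y\<close> is compared with the
  whole block of \<open>x\<close>, not with \<open>x\<close> at \<open>k\<close>. This freedom is
  what lets \<open>y\<close> be large where \<open>x\<close> is small.\<close>

lemma norm_le_of_block_norm:
  assumes "\<And>j k. j \<in> I \<Longrightarrow> k \<in> topspace (K j) \<Longrightarrow> N y k \<le> block_norm x j"
  shows "norm y \<le> norm x"
proof (rule norm_le_of_sums)
  fix F \<kappa>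
  assume F: "finite F" "F \<subseteq> I" "\<And>j. j \<in> F \<Longrightarrow> \<kappa> j \<in> topspace (K j)"
  have "(\<Sum>j\<in>F. N y (\<kappa> j) powr p) \<le> (\<Sum>j\<in>F. block_norm x j powr p)"
    using F p_ge_1 assms by (intro sum_mono powr_mono2 N_nonneg mem_index_union) auto
  also have "\<dots> \<le> norm x powr p"
    by (rule sum_block_norm_le[OF F(1,2)])
  finally show "(\<Sum>j\<in>F. N y (\<kappa> j) powr p) \<le> norm x powr p" .
qed simp

lemma module_element:
  assumes "\<And>i. i \<in> I \<Longrightarrow> continuous_map (K i) euclideanreal (\<phi> i)"
    and "\<And>i k. i \<in> I \<Longrightarrow> k \<in> topspace (K i) \<Longrightarrow> \<bar>\<phi> i k\<bar> \<le> B"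
  shows "\<exists>y. \<forall>i\<in>I. \<forall>k\<in>topspace (K i). \<forall>\<^sub>F t in filt k. R y k t = \<phi> i k * R x k t"
proof -
  obtain y where y: "\<forall>i\<in>I. has_coords (topspace (K i)) X R y (\<lambda>k t. \<phi> i k * R x k t)"
    using module[of \<phi> x] assms by blast
  then show ?thesis
    by (intro exI[of _ y]) (auto simp: has_coords_def eqv_iff_filt mem_index_union)
qed

section \<open>The p-sum of two elements and its norm\<close>

lemma p_add_coords:
  assumes "k \<in> U"
  shows "\<forall>\<^sub>F t in filt k. R (p_add p U X R f g) k t =
    spow (1 / p) (spow p (R f k t) + spow p (R g k t))"
proof -
  let ?z = "\<lambda>k t. spow (1 / p) (spow p (R f k t) + spow p (R g k t))"
  obtain y where y: "has_coords U X R y ?z"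
    using p_sum[where n = 2 and xs = "\<lambda>\<nu>. if \<nu> = 0 then f else g"]
    by (auto simp: numeral_2_eq_2)
  \<comment> \<open>The description in \<open>p_add\<close> is proper: existence is the case of two
    summands in \<open>p_sum\<close>, and uniqueness is injectivity of the coordinates.\<close>
  have "\<exists>!y. has_coords U X R y ?z"
  proof (rule ex1I[where a = y], rule y)
    fix y' assume y': "has_coords U X R y' ?z"
    show "y' = y"
    proof (rule R_eqI)
      fix k assume "k \<in> U"
      then have "\<forall>\<^sub>F t in filt k. R y' k t = ?z k t" "\<forall>\<^sub>F t in filt k. R y k t = ?z k t"
        using y y' by (auto simp: has_coords_def eqv_iff_filt)
      then show "\<forall>\<^sub>F t in filt k. R y' k t = R y k t"
        by eventually_elim simp
    qed
  qed
  then have "has_coords U X R (p_add p U X R f g) ?z"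
    unfolding p_add_def by (rule theI')
  then show ?thesis
    using assms by (simp add: has_coords_def eqv_iff_filt)
qed

text \<open>Convexity holds in each coordinate space. A choice of points used for the p-sum may be
  used in the norm formulas of \<open>f\<close> and of \<open>g\<close> as well, so the sum over it
  splits into two sums bounded by the two norms.\<close>

lemma norm_p_add_le: "norm (p_add p U X R f g) \<le> (norm f powr p + norm g powr p) powr (1 / p)"
proof (rule norm_le_of_sums)
  fix F \<kappa>
  assume F: "finite F" "F \<subseteq> I" "\<And>j. j \<in> F \<Longrightarrow> \<kappa> j \<in> topspace (K j)"
  have "N (p_add p U X R f g) k powr p \<le> N f k powr p + N g k powr p" if k: "k \<in> U" for k
  proof (rule p_convex_space.p_convex[OF p_convex_space_filt[OF k]])
    show "\<forall>\<^sub>F t in filt k. \<bar>R (p_add p U X R f g) k t\<bar> powr p \<le> \<bar>R f k t\<bar> powr p + \<bar>R g k t\<bar> powr p"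
      using p_add_coords[OF k, of f g]
      by eventually_elim (use powr_abs_spow_add_le p_ge_1 in auto)
  qed (auto intro: coord_mem k)
  then have "(\<Sum>j\<in>F. N (p_add p U X R f g) (\<kappa> j) powr p) \<le>
      (\<Sum>j\<in>F. N f (\<kappa> j) powr p) + (\<Sum>j\<in>F. N g (\<kappa> j) powr p)"
    unfolding sum.distrib[symmetric] using F by (intro sum_mono) (auto intro: mem_index_union)
  also have "\<dots> \<le> norm f powr p + norm g powr p"
    using F by (intro add_mono sum_N_powr_le_norm) auto
  finally show "(\<Sum>j\<in>F. N (p_add p U X R f g) (\<kappa> j) powr p) \<le>
      ((norm f powr p + norm g powr p) powr (1 / p)) powr p"
    using p_ge_1 by (simp add: powr_powr)
qed simp

text \<open>The p-sum of two multiples of one function is again a multiple of it, so homogeneity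
  gives equality where convexity gives only an upper bound. The factors must not have opposite
  signs, since signed powers would then cancel.\<close>

lemma N_p_add_multiples:
  assumes k: "k \<in> U" and "a \<ge> 0" "b \<ge> 0"
    and f: "\<forall>\<^sub>F t in filt k. R f k t = a * R v k t"
    and g: "\<forall>\<^sub>F t in filt k. R g k t = b * R v k t"
  shows "N (p_add p U X R f g) k powr p = N f k powr p + N g k powr p"
proof -
  have "\<forall>\<^sub>F t in filt k. R (p_add p U X R f g) k t = (a powr p + b powr p) powr (1 / p) * R v k t"
    using p_add_coords[OF k, of f g] f g
    by eventually_elim (use assms p_ge_1 in \<open>simp add: spow_add_scaled\<close>)
  then have "N (p_add p U X R f g) k = (a powr p + b powr p) powr (1 / p) * N v k"
    using N_multiple[OF k, of _ "(a powr p + b powr p) powr (1 / p)" v] by simp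
  moreover have "N f k = a * N v k" "N g k = b * N v k"
    using N_multiple[OF k f] N_multiple[OF k g] assms by auto
  ultimately show ?thesis
    using p_ge_1 assms N_nonneg[OF k, of v] by (simp add: powr_mult powr_powr algebra_simps)
qed

section \<open>Perturbing a vector where a functional is small\<close>

lemma sum_module_coords:
  fixes m :: nat
  assumes "k \<in> U" "\<And>n. n < m \<Longrightarrow> \<forall>\<^sub>F t in filt k. R (u n) k t = \<psi> n * R z k t"
  shows "\<forall>\<^sub>F t in filt k. R (\<Sum>n<m. s n *\<^sub>R u n) k t = (\<Sum>n<m. s n * \<psi> n) * R z k t"
  using assms(2)
proof (induct m)
  case 0
  then show ?case
    using eventually_R_0[OF assms(1)] by simp
next
  case (Suc m)
  have "\<forall>\<^sub>F t in filt k. R (\<Sum>n<m. s n *\<^sub>R u n) k t = (\<Sum>n<m. s n * \<psi> n) * R z k t"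
    using Suc by simp
  then show ?case
    using Suc(2)[of m, OF lessI] eventually_R_scale[OF assms(1), of "s m" "u m"]
      eventually_R_add[OF assms(1), of "\<Sum>n<m. s n *\<^sub>R u n" "s m *\<^sub>R u m"]
    by eventually_elim (simp add: algebra_simps)
qed

text \<open>
  The signed sums of the pieces of \<open>z\<close> cut out by the peaks have norm at most \<open>norm z\<close>, so a
  bounded functional cannot be large on all of them.
\<close>

lemma small_peak:
  fixes h :: "'x \<Rightarrow> real"
  assumes "bounded_linear h" "finite F" "F \<subseteq> I" "\<delta> > 0"
    and S: "\<And>j. j \<in> F \<Longrightarrow> infinite (S j) \<and> S j \<subseteq> topspace (K j)"
  shows "\<exists>\<kappa> \<phi> u. (\<forall>j\<in>F. \<kappa> j \<in> S j \<and> \<phi> j (\<kappa> j) = 1) \<and> (\<forall>j k. 0 \<le> \<phi> j k \<and> \<phi> j k \<le> 1) \<and>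
    (\<forall>j\<in>I. \<forall>k\<in>topspace (K j). \<forall>\<^sub>F t in filt k. R u k t = \<phi> j k * R z k t) \<and> \<bar>h u\<bar> < \<delta>"
proof -
  interpret h: bounded_linear h by fact
  obtain H where H: "0 \<le> H" "\<And>x. \<bar>h x\<bar> \<le> norm x * H"
    using h.nonneg_bounded by auto
  \<comment> \<open>So many peaks that \<open>m\<close> times \<delta> exceeds the bound
    \<open>norm z * H\<close> for the functional.\<close>
  obtain m :: nat where m: "norm z * H / \<delta> < real m"
    using reals_Archimedean2 by blast
  define Q where "Q = (\<lambda>j \<kappa> \<psi>. \<forall>n<m. \<kappa> n \<in> S j \<and> continuous_map (K j) euclideanreal (\<psi> n) \<and>
    \<psi> n (\<kappa> n) = 1 \<and> (\<forall>k. 0 \<le> \<psi> n k \<and> (\<Sum>l<m. \<psi> l k) \<le> 1))"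
  have "\<exists>\<kappa> \<psi>. Q j \<kappa> \<psi>" if "j \<in> F" for j
    unfolding Q_def using that S assms(3) compact Hausdorff by (intro peaks_in_infinite_set) auto
  then obtain \<kappa> \<psi> where Q: "\<And>j. j \<in> F \<Longrightarrow> Q j (\<kappa> j) (\<psi> j)"
    by metis
  have \<psi>: "\<kappa> j n \<in> S j \<and> continuous_map (K j) euclideanreal (\<psi> j n) \<and> \<psi> j n (\<kappa> j n) = 1 \<and>
      (\<forall>k. 0 \<le> \<psi> j n k \<and> (\<Sum>l<m. \<psi> j l k) \<le> 1)" if "j \<in> F" "n < m" for j n
    using Q[OF that(1)] that(2) by (simp add: Q_def)
  define \<phi> where "\<phi> = (\<lambda>n j k. if j \<in> F then \<psi> j n k else 0)"
  have \<phi>_nonneg: "0 \<le> \<phi> n j k" if "n < m" for n j k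
    using \<psi> that by (simp add: \<phi>_def)
  \<comment> \<open>The bound in \<open>Q\<close> is available only for an index below
    \<open>m\<close>; for \<open>m = 0\<close> the sum is empty.\<close>
  have \<phi>_sum: "(\<Sum>n<m. \<phi> n j k) \<le> 1" for j k
    using \<psi>[of j 0] by (cases "j \<in> F"; cases "m = 0") (simp_all add: \<phi>_def)
  have \<phi>_le_1: "\<phi> n j k \<le> 1" if "n < m" for n j k
    using member_le_sum[of n "{..<m}" "\<lambda>n. \<phi> n j k"] \<phi>_nonneg \<phi>_sum[of j k] that by force
  have "\<exists>u. \<forall>i\<in>I. \<forall>k\<in>topspace (K i). \<forall>\<^sub>F t in filt k. R u k t = \<phi> n i k * R z k t"
    if "n < m" for n
  proof (rule module_element[where B = 1])
    fix i assume "i \<in> I"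
    show "continuous_map (K i) euclideanreal (\<phi> n i)"
      using \<psi> that by (cases "i \<in> F") (auto simp: \<phi>_def)
  qed (use \<phi>_nonneg \<phi>_le_1 that in \<open>simp add: abs_of_nonneg\<close>)
  then obtain u where u: "\<And>n i k. n < m \<Longrightarrow> i \<in> I \<Longrightarrow> k \<in> topspace (K i) \<Longrightarrow>
      \<forall>\<^sub>F t in filt k. R (u n) k t = \<phi> n i k * R z k t"
    by metis
  \<comment> \<open>The signs make \<open>h w\<close> the sum of all |h (u n)|, while the peaks,
    summing to at most 1, keep the coordinates of \<open>w\<close> no larger in norm than those of
    \<open>z\<close>.\<close>
  define w where "w = (\<Sum>n<m. sgn (h (u n)) *\<^sub>R u n)"
  have "norm w \<le> norm z"
  proof (rule norm_le_of_block_norm)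
    fix i k assume i: "i \<in> I" and k: "k \<in> topspace (K i)"
    have "\<forall>\<^sub>F t in filt k. R w k t = (\<Sum>n<m. sgn (h (u n)) * \<phi> n i k) * R z k t"
      unfolding w_def using i k u by (intro sum_module_coords mem_index_union) auto
    then have "N w k = \<bar>\<Sum>n<m. sgn (h (u n)) * \<phi> n i k\<bar> * N z k"
      by (rule N_multiple[OF mem_index_union[OF i k]])
    also have "\<bar>\<Sum>n<m. sgn (h (u n)) * \<phi> n i k\<bar> \<le> (\<Sum>n<m. \<bar>sgn (h (u n)) * \<phi> n i k\<bar>)"
      by (rule sum_abs)
    also have "\<dots> \<le> (\<Sum>n<m. \<phi> n i k)"
      using \<phi>_nonneg by (intro sum_mono) (auto simp: abs_mult abs_sgn_eq)
    also have "\<dots> \<le> 1"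
      by (rule \<phi>_sum)
    finally have "N w k \<le> N z k"
      using N_nonneg[OF mem_index_union[OF i k]] by (simp add: mult_right_mono)
    then show "N w k \<le> block_norm z i"
      using N_le_block_norm[OF i k, of z] by simp
  qed
  have "\<exists>n<m. \<bar>h (u n)\<bar> < \<delta>"
  proof (rule ccontr)
    assume "\<not> ?thesis"
    then have "(\<Sum>n<m. \<delta>) \<le> (\<Sum>n<m. \<bar>h (u n)\<bar>)"
      by (intro sum_mono) (meson lessThan_iff not_less)
    also have "\<dots> = h w"
      by (simp add: w_def h.sum h.scaleR abs_sgn mult.commute)
    also have "\<dots> \<le> norm w * H"
      using H(2)[of w] by linarith
    also have "\<dots> \<le> norm z * H"
      using \<open>norm w \<le> norm z\<close> H(1) by (rule mult_right_mono)
    finally show False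
      using m \<open>\<delta> > 0\<close> by (simp add: field_simps)
  qed
  then obtain n where n: "n < m" "\<bar>h (u n)\<bar> < \<delta>" by blast
  show ?thesis
  proof (intro exI[of _ "\<lambda>j. \<kappa> j n"] exI[of _ "\<phi> n"] exI[of _ "u n"] conjI ballI allI)
    show "\<kappa> j n \<in> S j" "\<phi> n j (\<kappa> j n) = 1" if "j \<in> F" for j
      using \<psi>[OF that n(1)] that by (simp_all add: \<phi>_def)
    show "0 \<le> \<phi> n j k" "\<phi> n j k \<le> 1" for j k
      using \<phi>_nonneg \<phi>_le_1 n(1) by simp_all
    show "\<forall>\<^sub>F t in filt k. R (u n) k t = \<phi> n j k * R z k t"
      if "j \<in> I" "k \<in> topspace (K j)" for j k
      using u[OF n(1) that] .
  qed (rule n(2))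
qed

lemma eventually_R_eq_0:
  assumes "i \<in> I" "k \<in> topspace (K i)" "block_norm y i = 0"
  shows "\<forall>\<^sub>F t in filt k. R y k t = 0"
proof -
  have k: "k \<in> U"
    using assms by (blast intro: mem_index_union)
  have "N y k = 0"
    using N_le_block_norm[OF assms(1,2), of y] N_nonneg[OF k, of y] assms(3) by simp
  then show ?thesis
    by (rule p_convex_space.zero_cond[OF p_convex_space_filt[OF k] coord_mem[OF k]])
qed

text \<open>
  At one point of each of finitely many blocks carrying most of \<open>f\<close> and \<open>y\<close>, replace \<open>f\<close> by a
  nonnegative multiple of \<open>y\<close> of the same size, by means of peaks on which the functional \<open>h\<close> is
  small. On blocks where \<open>y\<close> vanishes nothing has to be changed.
\<close>

lemma aligned_perturbation:
  fixes h :: "'x \<Rightarrow> real"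
  assumes "bounded_linear h" "h f = 1" and q: "0 < q" "q < 1" and "f \<noteq> 0" "y \<noteq> 0"
  obtains g where "norm g \<le> norm f" "q \<le> h g"
    "(q * (q * norm f)) powr p + (q * h g * (q * norm y)) powr p
      \<le> norm (p_add p U X R g (h g *\<^sub>R y)) powr p"
proof -
  interpret h: bounded_linear h by fact
  obtain F1 where F1: "finite F1" "F1 \<subseteq> I" "\<And>F'. finite F' \<Longrightarrow> F1 \<subseteq> F' \<Longrightarrow> F' \<subseteq> I \<Longrightarrow>
      (q * norm f) powr p \<le> (\<Sum>j\<in>F'. block_norm f j powr p)"
    using q assms(5) by (rule_tac finite_block_norm_approx[of "q * norm f" f]) auto
  obtain F2 where F2: "finite F2" "F2 \<subseteq> I" "\<And>F'. finite F' \<Longrightarrow> F2 \<subseteq> F' \<Longrightarrow> F' \<subseteq> I \<Longrightarrow>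
      (q * norm y) powr p \<le> (\<Sum>j\<in>F'. block_norm y j powr p)"
    using q assms(6) by (rule_tac finite_block_norm_approx[of "q * norm y" y]) auto
  define F where "F = F1 \<union> F2"
  have F: "finite F" "F \<subseteq> I"
    using F1 F2 by (auto simp: F_def)
  define A where "A = {j \<in> F. block_norm y j \<noteq> 0}"
  \<comment> \<open>The factor that gives \<open>y\<close> the block norm of \<open>f\<close> on
    block \<open>j\<close>. It is 0 outside \<open>A\<close>, where no replacement takes
    place.\<close>
  define c where "c = (\<lambda>j. if j \<in> A then block_norm f j / block_norm y j else 0)"
  have c_nonneg: "0 \<le> c j" for j
    by (simp add: c_def block_norm_nonneg)
  \<comment> \<open>The module property needs one bound for all blocks; finiteness of
    \<open>F\<close> provides it.\<close>
  have c_le: "\<bar>c j\<bar> \<le> (\<Sum>j\<in>F. c j)" for j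
  proof (cases "j \<in> F")
    case True
    then show ?thesis
      using member_le_sum[of j F c] F(1) c_nonneg by simp
  next
    case False
    then have "c j = 0"
      by (simp add: c_def A_def)
    then show ?thesis
      using sum_nonneg[of F c] c_nonneg by simp
  qed
  \<comment> \<open>On blocks in \<open>A\<close>, \<open>z1\<close> is the intended replacement for
    \<open>f\<close> and \<open>z2\<close> is \<open>f\<close> itself; on all other blocks both
    vanish. Hence adding a peak times \<open>z1 - z2\<close> to \<open>f\<close> performs the
    replacement near the peak only.\<close>
  obtain z1 where z1: "\<forall>i\<in>I. \<forall>k\<in>topspace (K i). \<forall>\<^sub>F t in filt k. R z1 k t = c i * R y k t"
    using module_element[of "\<lambda>i k. c i" "\<Sum>j\<in>F. c j" y] c_le by auto
  obtain z2 where z2: "\<forall>i\<in>I. \<forall>k\<in>topspace (K i). \<forall>\<^sub>F t in filt k. R z2 k t = of_bool (i \<in> A) * R f k t"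
    using module_element[of "\<lambda>i k. of_bool (i \<in> A)" 1 f] by auto
  \<comment> \<open>On blocks in \<open>A\<close> points where \<open>y\<close> is almost maximal
    suffice for \<open>f\<close> too, because there \<open>g\<close> will be \<open>c j\<close>
    times \<open>y\<close>. On the remaining blocks of \<open>F\<close> only \<open>f\<close>
    matters.\<close>
  define S where "S = (\<lambda>j. if j \<in> A then {k \<in> topspace (K j). N y k \<ge> q * block_norm y j}
    else {k \<in> topspace (K j). N f k \<ge> q * block_norm f j})"
  have "infinite (S j) \<and> S j \<subseteq> topspace (K j)" if "j \<in> F" for j
    using infinite_almost_block_norm[of j "1 - q"] that F(2) q(2) by (auto simp: S_def)
  then have "\<exists>\<kappa> \<phi> u. (\<forall>j\<in>F. \<kappa> j \<in> S j \<and> \<phi> j (\<kappa> j) = 1) \<and> (\<forall>j k. 0 \<le> \<phi> j k \<and> \<phi> j k \<le> 1) \<and>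
    (\<forall>j\<in>I. \<forall>k\<in>topspace (K j). \<forall>\<^sub>F t in filt k. R u k t = \<phi> j k * R (z1 - z2) k t) \<and> \<bar>h u\<bar> < 1 - q"
    using q(2) by (intro small_peak[OF assms(1) F]) auto
  then obtain \<kappa> u and \<phi> :: "'i \<Rightarrow> 'k \<Rightarrow> real" where "\<forall>j\<in>F. \<kappa> j \<in> S j \<and> \<phi> j (\<kappa> j) = 1"
    and "\<forall>j k. 0 \<le> \<phi> j k \<and> \<phi> j k \<le> 1"
    and "\<forall>j\<in>I. \<forall>k\<in>topspace (K j). \<forall>\<^sub>F t in filt k. R u k t = \<phi> j k * R (z1 - z2) k t"
    and hu: "\<bar>h u\<bar> < 1 - q"
    by (elim exE conjE)
  note \<kappa> = this(1)[rule_format] and \<phi> = this(2)[rule_format] and u = this(3)[rule_format]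
  have \<kappa>_mem: "\<kappa> j \<in> topspace (K j)" if "j \<in> F" for j
    using \<kappa>[OF that] by (cases "j \<in> A") (auto simp: S_def)
  \<comment> \<open>On a block in \<open>A\<close> this is the convex combination of
    \<open>f\<close> and \<open>c j\<close> times \<open>y\<close> with weight
    \<open>\<phi> j k\<close>; elsewhere it is \<open>f\<close>. As \<open>h f = 1\<close> and |h u|
    < 1 - q, the value \<open>h g\<close> is at least \<open>q\<close>, in particular
    positive.\<close>
  define g where "g = f + u"
  have g: "\<forall>\<^sub>F t in filt k. R g k t =
      (1 - \<phi> j k * of_bool (j \<in> A)) * R f k t + (\<phi> j k * c j) * R y k t"
    if j: "j \<in> I" and k: "k \<in> topspace (K j)" for j k
    using u[OF j k] z1[rule_format, OF j k] z2[rule_format, OF j k]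
      eventually_R_diff[OF mem_index_union[OF j k], of z1 z2]
      eventually_R_add[OF mem_index_union[OF j k], of f u]
    unfolding g_def by eventually_elim (simp add: algebra_simps)
  have norm_g: "norm g \<le> norm f"
  proof (rule norm_le_of_block_norm)
    fix j k assume j: "j \<in> I" and k: "k \<in> topspace (K j)"
    have "N g k \<le> \<bar>1 - \<phi> j k * of_bool (j \<in> A)\<bar> * N f k + \<bar>\<phi> j k * c j\<bar> * N y k"
      by (rule N_combination_le[OF mem_index_union[OF j k] g[OF j k]])
    \<comment> \<open>On \<open>A\<close> both terms of the convex combination are at most the block
      norm of \<open>f\<close>, by the choice of \<open>c\<close>.\<close>
    also have "\<dots> \<le> block_norm f j"
    proof (cases "j \<in> A")
      case True
      have "c j * N y k \<le> c j * block_norm y j"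
        by (intro mult_left_mono N_le_block_norm j k c_nonneg)
      also have "\<dots> = block_norm f j"
        using True by (simp add: c_def A_def)
      finally have "(1 - \<phi> j k) * N f k + \<phi> j k * (c j * N y k)
          \<le> (1 - \<phi> j k) * block_norm f j + \<phi> j k * block_norm f j"
        using \<phi>[of j k] by (intro add_mono mult_left_mono N_le_block_norm j k) auto
      then show ?thesis
        using True \<phi>[of j k] c_nonneg[of j] by (simp add: algebra_simps abs_mult)
    next
      case False
      then show ?thesis
        using N_le_block_norm[OF j k] by (simp add: c_def)
    qed
    finally show "N g k \<le> block_norm f j" .
  qed
  have hg: "q \<le> h g"
    using hu by (simp add: g_def h.add assms(2))
  let ?w = "p_add p U X R g (h g *\<^sub>R y)"
  have N_w: "(q * block_norm f j) powr p + (q * h g * block_norm y j) powr p \<le> N ?w (\<kappa> j) powr p"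
    if "j \<in> F" for j
  proof -
    have j: "j \<in> I" and k: "\<kappa> j \<in> topspace (K j)"
      using that F(2) \<kappa>_mem by auto
    note U = mem_index_union[OF j k]
    have Ty: "\<forall>\<^sub>F t in filt (\<kappa> j). R (h g *\<^sub>R y) (\<kappa> j) t = h g * R y (\<kappa> j) t"
      by (rule eventually_R_scale[OF U])
    \<comment> \<open>At the chosen point of a block in \<open>A\<close> the peak equals 1, so
      \<open>f\<close> disappears and both \<open>g\<close> and \<open>h g *\<^sub>R y\<close> are
      nonnegative multiples of \<open>y\<close>. On the other blocks of \<open>F\<close> the second
      vector vanishes, which makes it the multiple of \<open>f\<close> by 0.\<close>
    have "N ?w (\<kappa> j) powr p = N g (\<kappa> j) powr p + N (h g *\<^sub>R y) (\<kappa> j) powr p \<and>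
      q * block_norm f j \<le> N g (\<kappa> j) \<and> q * h g * block_norm y j \<le> N (h g *\<^sub>R y) (\<kappa> j)"
    proof (cases "j \<in> A")
      case True
      have g': "\<forall>\<^sub>F t in filt (\<kappa> j). R g (\<kappa> j) t = c j * R y (\<kappa> j) t"
        using g[OF j k] \<kappa>[OF that] True by simp
      have y: "q * block_norm y j \<le> N y (\<kappa> j)"
        using \<kappa>[OF that] True by (simp add: S_def)
      have "q * block_norm f j = c j * (q * block_norm y j)"
        using True by (simp add: c_def A_def)
      also have "\<dots> \<le> N g (\<kappa> j)"
        using y c_nonneg[of j] N_multiple[OF U g'] by (simp add: mult_left_mono)
      finally show ?thesis
        using N_p_add_multiples[OF U _ _ g' Ty] c_nonneg[of j] N_multiple[OF U Ty] hg q y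
          mult_left_mono[OF y, of "h g"] by (simp add: mult_ac)
    next
      case False
      then have y0: "block_norm y j = 0"
        using that by (simp add: A_def)
      have g': "\<forall>\<^sub>F t in filt (\<kappa> j). R g (\<kappa> j) t = 1 * R f (\<kappa> j) t"
        using g[OF j k] False by (simp add: c_def)
      have Ty': "\<forall>\<^sub>F t in filt (\<kappa> j). R (h g *\<^sub>R y) (\<kappa> j) t = 0 * R f (\<kappa> j) t"
        using Ty eventually_R_eq_0[OF j k y0] by eventually_elim simp
      then show ?thesis
        using N_p_add_multiples[OF U _ _ g' Ty'] N_multiple[OF U g'] \<kappa>[OF that] False y0 N_nonneg[OF U]
        by (simp add: S_def)
    qed
    then show ?thesis
      using q hg p_ge_1 block_norm_nonneg by (auto intro!: add_mono powr_mono2)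
  qed
  have "(q * (q * norm f)) powr p + (q * h g * (q * norm y)) powr p
      = q powr p * (q * norm f) powr p + (q * h g) powr p * (q * norm y) powr p"
    using q hg by (simp add: powr_mult)
  also have "\<dots> \<le> q powr p * (\<Sum>j\<in>F. block_norm f j powr p) + (q * h g) powr p * (\<Sum>j\<in>F. block_norm y j powr p)"
    using F F1(3)[of F] F2(3)[of F] by (intro add_mono mult_left_mono) (auto simp: F_def)
  also have "\<dots> = (\<Sum>j\<in>F. (q * block_norm f j) powr p + (q * h g * block_norm y j) powr p)"
    using q hg block_norm_nonneg by (simp add: powr_mult sum.distrib sum_distrib_left)
  also have "\<dots> \<le> (\<Sum>j\<in>F. N ?w (\<kappa> j) powr p)"
    by (intro sum_mono N_w)
  also have "\<dots> \<le> norm ?w powr p"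
    using F \<kappa>_mem by (intro sum_N_powr_le_norm) auto
  finally show thesis
    by (rule that[OF norm_g hg])
qed

section \<open>Rank one operators and the p-Daugavet equation\<close>

lemma p_add_norm_lower_bound:
  assumes "bounded_linear T" and b: "b \<noteq> 0" "\<And>x. \<exists>c. T x = c *\<^sub>R b"
    and pos: "0 < onorm T" and q: "0 < q" "q < 1"
  shows "\<exists>g\<in>cball 0 1. q ^ 4 * (1 + onorm T powr p) powr (1 / p) \<le> norm (p_add p U X R g (T g))"
proof -
  interpret T: bounded_linear T by fact
  have "\<exists>x. q * onorm T < norm (T x) / norm x"
  proof (rule ccontr)
    assume "\<not> ?thesis"
    then have "onorm T \<le> q * onorm T"
      unfolding onorm_def by (intro cSUP_least) (auto simp: not_less)
    then show False
      using pos q by simp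
  qed
  then obtain x where x: "q * onorm T < norm (T x) / norm x" by blast
  \<comment> \<open>At 0 the quotient is 0, since division by zero yields 0, and so it cannot exceed
    \<open>q * onorm T\<close>.\<close>
  have "x \<noteq> 0"
    using x mult_pos_pos[OF q(1) pos] by auto
  define f where "f = (1 / norm x) *\<^sub>R x"
  define y where "y = T f"
  have f: "norm f = 1"
    using \<open>x \<noteq> 0\<close> by (simp add: f_def)
  have y: "q * onorm T < norm y"
    using x by (simp add: y_def f_def T.scaleR)
  then have "y \<noteq> 0"
    using pos q by (auto simp: not_less dest: order.strict_trans[OF mult_pos_pos])
  \<comment> \<open>Being nonzero, \<open>y\<close> spans the same line as \<open>b\<close>. Taking
    \<open>y = T f\<close> as the spanning vector normalises the functional to
    \<open>h f = 1\<close>.\<close>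
  have "\<exists>c. T v = c *\<^sub>R y" for v
  proof -
    obtain c0 where c0: "y = c0 *\<^sub>R b"
      using b(2) y_def by metis
    obtain c where c: "T v = c *\<^sub>R b"
      using b(2) by metis
    have "c0 \<noteq> 0"
      using c0 \<open>y \<noteq> 0\<close> by auto
    then have "T v = (c / c0) *\<^sub>R y"
      by (simp add: c c0)
    then show ?thesis ..
  qed
  then obtain h where h: "\<And>v. T v = h v *\<^sub>R y"
    by metis
  have "bounded_linear h"
  proof (rule bounded_linear_intro[where K = "onorm T / norm y"])
    show "h (v + w) = h v + h w" for v w
    proof -
      have "h (v + w) *\<^sub>R y = (h v + h w) *\<^sub>R y"
        by (simp only: h[symmetric] T.add scaleR_add_left)
      then show ?thesis
        using \<open>y \<noteq> 0\<close> by simp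
    qed
    show "h (r *\<^sub>R v) = r *\<^sub>R h v" for r v
    proof -
      have "h (r *\<^sub>R v) *\<^sub>R y = (r * h v) *\<^sub>R y"
        by (simp only: h[symmetric] T.scaleR flip: scaleR_scaleR)
      then show ?thesis
        using \<open>y \<noteq> 0\<close> by simp
    qed
    show "norm (h v) \<le> norm v * (onorm T / norm y)" for v
      using onorm[OF assms(1), of v] \<open>y \<noteq> 0\<close> by (simp add: h field_simps)
  qed
  moreover have "h f = 1"
  proof -
    have "h f *\<^sub>R y = 1 *\<^sub>R y"
      using h[of f] by (simp flip: y_def)
    then show ?thesis
      using \<open>y \<noteq> 0\<close> by (auto simp only: scaleR_cancel_right)
  qed
  moreover have "f \<noteq> 0"
    using f by auto
  ultimately obtain g where g: "norm g \<le> norm f" "q \<le> h g"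
    "(q * (q * norm f)) powr p + (q * h g * (q * norm y)) powr p
      \<le> norm (p_add p U X R g (h g *\<^sub>R y)) powr p"
    using q \<open>y \<noteq> 0\<close> by (rule_tac aligned_perturbation)
  \<comment> \<open>Four factors \<open>q\<close> are lost in the part of \<open>T g\<close>: in the
    choice of \<open>f\<close>, in \<open>h g\<close>, in passing to finitely many blocks, and at
    the points chosen there. The part of \<open>g\<close> loses only the last two, and is weakened
    to the same power.\<close>
  have "q ^ 4 * 1 \<le> q * (q * norm f)"
    using q f power_decreasing[of 2 4 q] by (simp add: power2_eq_square)
  moreover have "q ^ 4 * onorm T \<le> q * h g * (q * norm y)"
  proof -
    have "q * q * (q * (q * onorm T)) \<le> q * h g * (q * norm y)"
      using q g(2) y pos by (intro mult_mono) auto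
    then show ?thesis
      by (simp add: power4_eq_xxxx mult_ac)
  qed
  ultimately have "(q ^ 4 * 1) powr p + (q ^ 4 * onorm T) powr p
      \<le> norm (p_add p U X R g (h g *\<^sub>R y)) powr p"
    using q pos p_ge_1 by (intro order_trans[OF _ g(3)] add_mono powr_mono2) auto
  then have "(q ^ 4) powr p * (1 + onorm T powr p) \<le> norm (p_add p U X R g (T g)) powr p"
    using q pos by (simp add: powr_mult h[of g] algebra_simps)
  then have "((q ^ 4) powr p * (1 + onorm T powr p)) powr (1 / p)
      \<le> (norm (p_add p U X R g (T g)) powr p) powr (1 / p)"
    using p_ge_1 by (intro powr_mono2) auto
  then have "q ^ 4 * (1 + onorm T powr p) powr (1 / p) \<le> norm (p_add p U X R g (T g))"
    using p_ge_1 q by (simp add: powr_mult powr_powr)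
  then show ?thesis
    using g(1) f by (intro bexI[of _ g]) auto
qed

theorem p_Daugavet: "p_Daugavet p U X R"
  unfolding p_Daugavet_def
proof (intro allI impI)
  fix T :: "'x \<Rightarrow> 'x"
  assume "bounded_linear T \<and> dim (range T) = 1"
  then have T: "bounded_linear T" and dim: "dim (range T) = 1" by auto
  interpret T: bounded_linear T by fact
  obtain B where B: "B \<subseteq> range T" "independent B" "range T \<subseteq> span B" "card B = 1"
    using basis_exists[of "range T"] dim by metis
  then obtain b where b: "B = {b}"
    by (auto simp: card_1_singleton_iff)
  then have "b \<noteq> 0"
    using B(2) dependent_zero by blast
  have rank: "\<exists>c. T x = c *\<^sub>R b" for x
    using B(3) b by (auto simp: span_singleton)
  have pos: "0 < onorm T"
  proof -
    have "\<not> (\<forall>x. T x = 0)"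
      using B(1) b \<open>b \<noteq> 0\<close> by auto
    then show ?thesis
      by (simp add: onorm_pos_lt[OF T])
  qed
  define C where "C = (1 + onorm T powr p) powr (1 / p)"
  have "C > 0"
    using pos by (simp add: C_def) (smt (verit) powr_ge_zero)
  show "(SUP f\<in>cball 0 1. ereal (norm (p_add p U X R f (T f)))) = ereal C"
  proof (rule antisym)
    show "(SUP f\<in>cball 0 1. ereal (norm (p_add p U X R f (T f)))) \<le> ereal C"
    proof (rule SUP_least)
      fix f :: 'x assume f: "f \<in> cball 0 1"
      have "norm (T f) \<le> onorm T * 1"
        using onorm[OF T, of f] f pos by (meson dual_order.trans mem_cball_0 mult_left_mono less_imp_le)
      then have "norm f powr p + norm (T f) powr p \<le> 1 powr p + onorm T powr p"
        using f p_ge_1 by (intro add_mono powr_mono2) auto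
      then have "(norm f powr p + norm (T f) powr p) powr (1 / p) \<le> C"
        unfolding C_def using p_ge_1 by (intro powr_mono2) auto
      then show "ereal (norm (p_add p U X R f (T f))) \<le> ereal C"
        using norm_p_add_le[of f "T f"] by simp
    qed
    show "ereal C \<le> (SUP f\<in>cball 0 1. ereal (norm (p_add p U X R f (T f))))" (is "_ \<le> ?S")
    proof (rule ereal_le_epsilon2)
      fix e :: real assume "e > 0"
      \<comment> \<open>By Bernoulli, 1 - q^4 \<le> 4 (1 - q), so the loss
        \<open>(1 - q ^ 4) * C\<close> is at most \<open>e\<close>. The minimum with 1/2 keeps
        \<open>q\<close> positive.\<close>
      define q where "q = 1 - min (1 / 2) (e / (4 * C))"
      have q: "0 < q" "q < 1"
        using \<open>e > 0\<close> \<open>C > 0\<close> by (auto simp: q_def min_def)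
      have "1 - 4 * (1 - q) \<le> q ^ 4"
        using Bernoulli_inequality[of "q - 1" 4] q by (simp add: algebra_simps)
      moreover have "4 * (1 - q) * C \<le> e"
        using \<open>C > 0\<close> by (simp add: q_def min_def field_simps)
      ultimately have "C \<le> q ^ 4 * C + e"
        using mult_right_mono[of "1 - 4 * (1 - q)" "q ^ 4" C] \<open>C > 0\<close> by (simp add: algebra_simps)
      moreover obtain g where g: "g \<in> cball 0 1" "q ^ 4 * C \<le> norm (p_add p U X R g (T g))"
        using p_add_norm_lower_bound[OF T \<open>b \<noteq> 0\<close> rank pos q] unfolding C_def by blast
      ultimately have "ereal C \<le> ereal (norm (p_add p U X R g (T g))) + ereal e"
        by simp
      also have "\<dots> \<le> ?S + ereal e"
        using g(1) by (intro add_right_mono SUP_upper)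
      finally show "ereal C \<le> ?S + ereal e" .
    qed
  qed
qed

end

theorem proposition2p7:
  fixes p :: real
    and I :: "'i set"
    and K :: "'i \<Rightarrow> 'k topology"
    and X :: "'k \<Rightarrow> 'w fun_space"
    and R :: "'x::banach \<Rightarrow> 'k \<Rightarrow> 'w \<Rightarrow> real"
  assumes "1 \<le> p"
    and "\<And>i. i \<in> I \<Longrightarrow> compact_space (K i)"
    and "\<And>i. i \<in> I \<Longrightarrow> Hausdorff_space (K i)"
    and "disjoint_family_on (\<lambda>i. topspace (K i)) I"
    and "pK_representation p I K X R"
  shows "p_Daugavet p (index_union I K) X R"
proof -
  interpret pK_compact_representation p I K X R
    using assms by (intro pK_compact_representation.intro pK_compact_representation_axioms.intro)
  show ?thesis
    by (rule p_Daugavet)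
qed

end
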